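(* Let $(X_n)_{n\in\mathbb{T}}$ be a (possibly time-inhomogeneous, non-stationary) Markov chain on a finite state space $\mathbb{S}$ with current of reactive trajectories $f^{AB}(n)$. Then the discrete rate of transitions leaving $A$ satisfies, for $n,n+1\in\mathbb{T}$, $$k^{A\rightarrow}(n)=\sum_{i\in A,\ j\in\mathbb{S}}f^{AB}_{ij}(n),$$ and the discrete rate of transitions entering $B$ satisfies, for $n-1,n\in\mathbb{T}$, $$k^{\rightarrow B}(n)=\sum_{i\in\mathbb{S},\ j\in B}f^{AB}_{ij}(n-1).$$
   Context: $A,B\subset\mathbb{S}$ are non-empty disjoint subsets of the finite state space $\mathbb{S}$ with $C:=(A\cup B)^c$ non-empty. The time set is $\mathbb{T}=\mathbb{Z}$ or $\mathbb{T}=\{0,1,\dots,N-1\}$. For $S\subset\mathbb{S}$ and $n\in\mathbb{T}$: $\tau_S^+(n):=\inf\{k\in\mathbb{T}: k\ge n, X_k\in S\}$ ($\inf\emptyset:=\infty$), $\tau_S^-(n):=\sup\{k\in\mathbb{T}: k\le n, X_k\in S\}$ ($\sup\emptyset:=-\infty$). The current of reactive trajectories is, for $n,n+1\in\mathbb{T}$, $f^{AB}_{ij}(n):=\mathbb{P}(X_n=i,\ X_{n+1}=j,\ \tau_A^-(n)>\tau_B^-(n),\ \tau_B^+(n+1)<\tau_A^+(n+1))$. The discrete rates are $k^{A\rightarrow}(n):=\mathbb{P}(X_n\in A,\ \tau_B^+(n+1)<\tau_A^+(n+1))$ for $n,n+1\in\mathbb{T}$, and $k^{\rightarrow B}(n):=\mathbb{P}(X_n\in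 B,\ \tau_A^-(n-1)>\tau_B^-(n-1))$ for $n-1,n\in\mathbb{T}$. *)

theory Defs
  imports "HOL-Probability.Probability"
begin

text \<open>Time is discrete: the integers, or a finite window starting at \<open>0\<close>. Finite windows are
  embedded into \<^typ>\<open>int\<close> so that both cases share the type of the process.\<close>

definition time_set :: "int set \<Rightarrow> bool" where
  "time_set T \<longleftrightarrow> T = UNIV \<or> (\<exists>N::nat. T = {0..<int N})"

text \<open>A Markov chain with state space \<open>S\<close>, neither time-homogeneous nor stationary in general.
  For a bi-infinite time set there is no initial time, so the history may start at any
  \<open>m \<le> n\<close>; only histories of positive probability are conditioned on.\<close>

definition markov_chain ::
    "'w measure \<Rightarrow> int set \<Rightarrow> 's set \<Rightarrow> (int \<Rightarrow> 'w \<Rightarrow> 's) \<Rightarrow> bool" where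
  "markov_chain M T S X \<longleftrightarrow>
     prob_space M \<and>
     (\<forall>n\<in>T. X n \<in> measurable M (count_space S)) \<and>
     (\<forall>m n x j. m \<in> T \<and> n \<in> T \<and> n + 1 \<in> T \<and> m \<le> n \<and> j \<in> S \<and>
        \<P>(w in M. \<forall>k\<in>{m..n}. X k w = x k) > 0 \<longrightarrow>
        \<P>(w in M. X (n + 1) w = j \<bar> \<forall>k\<in>{m..n}. X k w = x k) =
        \<P>(w in M. X (n + 1) w = j \<bar> X n w = x n))"

text \<open>In \<^typ>\<open>ereal\<close> the conventions \<open>inf {} = \<infinity>\<close> and \<open>sup {} = -\<infinity>\<close> hold by definition of
  the lattice.\<close>

definition tau_plus ::
    "int set \<Rightarrow> (int \<Rightarrow> 'w \<Rightarrow> 's) \<Rightarrow> 's set \<Rightarrow> int \<Rightarrow> 'w \<Rightarrow> ereal" where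
  "tau_plus T X D n w = Inf {ereal (real_of_int k) | k. k \<in> T \<and> k \<ge> n \<and> X k w \<in> D}"

definition tau_minus ::
    "int set \<Rightarrow> (int \<Rightarrow> 'w \<Rightarrow> 's) \<Rightarrow> 's set \<Rightarrow> int \<Rightarrow> 'w \<Rightarrow> ereal" where
  "tau_minus T X D n w = Sup {ereal (real_of_int k) | k. k \<in> T \<and> k \<le> n \<and> X k w \<in> D}"

definition reactive_current ::
    "'w measure \<Rightarrow> int set \<Rightarrow> (int \<Rightarrow> 'w \<Rightarrow> 's) \<Rightarrow> 's set \<Rightarrow> 's set \<Rightarrow> 's \<Rightarrow> 's \<Rightarrow> int \<Rightarrow> real" where
  "reactive_current M T X A B i j n =
     \<P>(w in M. X n w = i \<and> X (n + 1) w = j \<and>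
        tau_minus T X A n w > tau_minus T X B n w \<and>
        tau_plus T X B (n + 1) w < tau_plus T X A (n + 1) w)"

definition rate_leaving ::
    "'w measure \<Rightarrow> int set \<Rightarrow> (int \<Rightarrow> 'w \<Rightarrow> 's) \<Rightarrow> 's set \<Rightarrow> 's set \<Rightarrow> int \<Rightarrow> real" where
  "rate_leaving M T X A B n =
     \<P>(w in M. X n w \<in> A \<and> tau_plus T X B (n + 1) w < tau_plus T X A (n + 1) w)"

definition rate_entering ::
    "'w measure \<Rightarrow> int set \<Rightarrow> (int \<Rightarrow> 'w \<Rightarrow> 's) \<Rightarrow> 's set \<Rightarrow> 's set \<Rightarrow> int \<Rightarrow> real" where
  "rate_entering M T X A B n =
     \<P>(w in M. X n w \<in> B \<and> tau_minus T X A (n - 1) w > tau_minus T X B (n - 1) w)"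

end

theory Submission imports Defs begin

text \<open>The two factors that define a reactive trajectory, coming last from \<open>A\<close> and going next to \<open>B\<close>,
  are not independent of the position of the chain: at a time at which the chain sits in \<open>A\<close>, the
  last visit to \<open>A \<union> B\<close> is the present one, so the chain trivially comes last from \<open>A\<close>
  (\<open>last_exit_immediate\<close>); at a time at which it sits in \<open>B\<close>, it trivially goes next to \<open>B\<close>
  (\<open>first_entrance_immediate\<close>). Hence the event behind the rate of leaving \<open>A\<close> already contains
  the missing condition on the past, and the event behind the rate of entering \<open>B\<close> the missing
  condition on the future. Each is thus the event of being reactive during one step whose start lies
  in \<open>A\<close>, respectively whose end lies in \<open>B\<close>. Splitting that event according to the start and the
  end of the step gives the sum of currents (\<open>sum_reactive_current\<close>).\<close>

text \<open>Writing the entrance and exit times as extrema over all times, with the neutral value inserted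
  at the times at which \<open>D\<close> is not visited, makes the index set independent of \<open>w\<close>. They are then
  extrema of countably many measurable functions.\<close>

lemma tau_plus_eq_INF:
  "tau_plus T X D n w = (INF k\<in>{k\<in>T. n \<le> k}. if X k w \<in> D then ereal (real_of_int k) else \<infinity>)"
  unfolding tau_plus_def
proof (rule antisym)
  show "Inf {ereal (real_of_int k) |k. k \<in> T \<and> n \<le> k \<and> X k w \<in> D}
    \<le> (INF k\<in>{k\<in>T. n \<le> k}. if X k w \<in> D then ereal (real_of_int k) else \<infinity>)"
    by (rule INF_greatest) (auto intro!: Inf_lower)
  show "(INF k\<in>{k\<in>T. n \<le> k}. if X k w \<in> D then ereal (real_of_int k) else \<infinity>)
    \<le> Inf {ereal (real_of_int k) |k. k \<in> T \<and> n \<le> k \<and> X k w \<in> D}"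
  proof (rule Inf_greatest)
    fix x assume "x \<in> {ereal (real_of_int k) |k. k \<in> T \<and> n \<le> k \<and> X k w \<in> D}"
    then obtain k where k: "x = ereal (real_of_int k)" "k \<in> T" "n \<le> k" "X k w \<in> D"
      by blast
    show "(INF k\<in>{k\<in>T. n \<le> k}. if X k w \<in> D then ereal (real_of_int k) else \<infinity>) \<le> x"
      by (rule INF_lower2[of k]) (simp_all add: k)
  qed
qed

lemma tau_minus_eq_SUP:
  "tau_minus T X D n w = (SUP k\<in>{k\<in>T. k \<le> n}. if X k w \<in> D then ereal (real_of_int k) else -\<infinity>)"
  unfolding tau_minus_def
proof (rule antisym)
  show "(SUP k\<in>{k\<in>T. k \<le> n}. if X k w \<in> D then ereal (real_of_int k) else -\<infinity>)
    \<le> Sup {ereal (real_of_int k) |k. k \<in> T \<and> k \<le> n \<and> X k w \<in> D}"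
    by (rule SUP_least) (auto intro!: Sup_upper)
  show "Sup {ereal (real_of_int k) |k. k \<in> T \<and> k \<le> n \<and> X k w \<in> D}
    \<le> (SUP k\<in>{k\<in>T. k \<le> n}. if X k w \<in> D then ereal (real_of_int k) else -\<infinity>)"
  proof (rule Sup_least)
    fix x assume "x \<in> {ereal (real_of_int k) |k. k \<in> T \<and> k \<le> n \<and> X k w \<in> D}"
    then obtain k where k: "x = ereal (real_of_int k)" "k \<in> T" "k \<le> n" "X k w \<in> D"
      by blast
    show "x \<le> (SUP k\<in>{k\<in>T. k \<le> n}. if X k w \<in> D then ereal (real_of_int k) else -\<infinity>)"
      by (rule SUP_upper2[of k]) (simp_all add: k)
  qed
qed

lemma measurable_tau_plus:
  assumes "\<And>k. k \<in> T \<Longrightarrow> X k \<in> measurable M (count_space S)"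
  shows "tau_plus T X D n \<in> borel_measurable M"
proof -
  have "(\<lambda>w. if X k w \<in> D then ereal (real_of_int k) else \<infinity>) \<in> borel_measurable M" if "k \<in> T" for k
    by (rule measurable_compose[OF assms[OF that]]) simp
  then have "(\<lambda>w. INF k\<in>{k\<in>T. n \<le> k}. if X k w \<in> D then ereal (real_of_int k) else \<infinity>)
      \<in> borel_measurable M"
    by (intro borel_measurable_INF) auto
  then show ?thesis
    by (simp add: tau_plus_eq_INF[abs_def])
qed

lemma measurable_tau_minus:
  assumes "\<And>k. k \<in> T \<Longrightarrow> X k \<in> measurable M (count_space S)"
  shows "tau_minus T X D n \<in> borel_measurable M"
proof -
  have "(\<lambda>w. if X k w \<in> D then ereal (real_of_int k) else -\<infinity>) \<in> borel_measurable M" if "k \<in> T" for k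
    by (rule measurable_compose[OF assms[OF that]]) simp
  then have "(\<lambda>w. SUP k\<in>{k\<in>T. k \<le> n}. if X k w \<in> D then ereal (real_of_int k) else -\<infinity>)
      \<in> borel_measurable M"
    by (intro borel_measurable_SUP) auto
  then show ?thesis
    by (simp add: tau_minus_eq_SUP[abs_def])
qed

text \<open>Time is discrete, so the visits to a set that misses the present state lie at distance at least
  one from the present. This keeps the inequality strict when the extremum is taken.\<close>

lemma last_exit_immediate:
  assumes "n \<in> T" and "X n w \<in> A" and "A \<inter> B = {}"
  shows "tau_minus T X B n w < tau_minus T X A n w"
proof -
  have "tau_minus T X B n w \<le> ereal (real_of_int (n - 1))"
    unfolding tau_minus_def
  proof (rule Sup_least)
    fix x assume "x \<in> {ereal (real_of_int k) |k. k \<in> T \<and> k \<le> n \<and> X k w \<in> B}"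
    then obtain k where k: "x = ereal (real_of_int k)" "k \<le> n" "X k w \<in> B"
      by blast
    have "k \<noteq> n"
      using k assms by auto
    then show "x \<le> ereal (real_of_int (n - 1))"
      using k by simp
  qed
  also have "\<dots> < ereal (real_of_int n)"
    by simp
  also have "\<dots> \<le> tau_minus T X A n w"
    unfolding tau_minus_def using assms by (intro Sup_upper) auto
  finally show ?thesis .
qed

lemma first_entrance_immediate:
  assumes "n \<in> T" and "X n w \<in> B" and "A \<inter> B = {}"
  shows "tau_plus T X B n w < tau_plus T X A n w"
proof -
  have "tau_plus T X B n w \<le> ereal (real_of_int n)"
    unfolding tau_plus_def using assms by (intro Inf_lower) auto
  also have "\<dots> < ereal (real_of_int (n + 1))"
    by simp
  also have "\<dots> \<le> tau_plus T X A n w"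
    unfolding tau_plus_def
  proof (rule Inf_greatest)
    fix x assume "x \<in> {ereal (real_of_int k) |k. k \<in> T \<and> n \<le> k \<and> X k w \<in> A}"
    then obtain k where k: "x = ereal (real_of_int k)" "n \<le> k" "X k w \<in> A"
      by blast
    have "k \<noteq> n"
      using k assms by auto
    then show "ereal (real_of_int (n + 1)) \<le> x"
      using k by simp
  qed
  finally show ?thesis .
qed

text \<open>Finite additivity: the pair of the start and the end of a step takes exactly one value.
  The sums of currents in both rate formulas are instances, with one of \<open>I\<close> and \<open>J\<close> the whole
  state space.\<close>

lemma sum_reactive_current:
  assumes "prob_space M" and X: "\<And>k. k \<in> T \<Longrightarrow> X k \<in> measurable M (count_space S)"
    and "finite I" and "finite J" and n: "n \<in> T" "n + 1 \<in> T"
  shows "(\<Sum>i\<in>I. \<Sum>j\<in>J. reactive_current M T X A B i j n) =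
    \<P>(w in M. X n w \<in> I \<and> X (n + 1) w \<in> J \<and> tau_minus T X A n w > tau_minus T X B n w \<and>
      tau_plus T X B (n + 1) w < tau_plus T X A (n + 1) w)"
proof -
  interpret prob_space M by fact
  note [measurable] = measurable_tau_plus[of T X M S, OF X] measurable_tau_minus[of T X M S, OF X]
  have pred: "Measurable.pred M (\<lambda>w. X k w \<in> D)" if "k \<in> T" for k D
    by (rule measurable_compose[OF X[OF that]]) simp
  note [measurable] = pred[OF n(1)] pred[OF n(2)]
  have eq: "Measurable.pred M (\<lambda>w. X k w = i)" if "k \<in> T" for k i
    using pred[OF that, of "{i}"] by simp
  note [measurable] = eq[OF n(1)] eq[OF n(2)]
  show ?thesis
    unfolding reactive_current_def sum.cartesian_product case_prod_beta
  proof (rule prob_sum[symmetric])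
    show "finite (I \<times> J)"
      using assms by simp
  qed (measurable, auto)
qed

theorem theorem2p8:
  fixes M :: "'w measure" and T :: "int set" and X :: "int \<Rightarrow> 'w \<Rightarrow> 's"
    and S A B :: "'s set"
  assumes "finite S"
    and "time_set T"
    and "markov_chain M T S X"
    and "A \<subseteq> S" and "B \<subseteq> S" and "A \<noteq> {}" and "B \<noteq> {}" and "A \<inter> B = {}"
    and "S - (A \<union> B) \<noteq> {}"
  shows "(\<forall>n. n \<in> T \<and> n + 1 \<in> T \<longrightarrow>
            rate_leaving M T X A B n = (\<Sum>i\<in>A. \<Sum>j\<in>S. reactive_current M T X A B i j n)) \<and>
         (\<forall>n. n - 1 \<in> T \<and> n \<in> T \<longrightarrow>
            rate_entering M T X A B n = (\<Sum>i\<in>S. \<Sum>j\<in>B. reactive_current M T X A B i j (n - 1)))"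
proof (intro conjI allI impI)
  have M: "prob_space M" and X: "\<And>k. k \<in> T \<Longrightarrow> X k \<in> measurable M (count_space S)"
    using assms(3) by (auto simp: markov_chain_def)
  have in_S: "X k w \<in> S" if "k \<in> T" "w \<in> space M" for k w
    using measurable_space[OF X[OF that(1)] that(2)] by simp
  have fin: "finite A" "finite B"
    using assms by (auto intro: finite_subset)
  fix n
  {
    assume n: "n \<in> T \<and> n + 1 \<in> T"
    have "{w \<in> space M. X n w \<in> A \<and> tau_plus T X B (n + 1) w < tau_plus T X A (n + 1) w} =
      {w \<in> space M. X n w \<in> A \<and> X (n + 1) w \<in> S \<and> tau_minus T X A n w > tau_minus T X B n w \<and>
        tau_plus T X B (n + 1) w < tau_plus T X A (n + 1) w}"
      using n by (intro Collect_cong)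
        (simp add: in_S last_exit_immediate[OF _ _ assms(8)] cong: conj_cong)
    then show "rate_leaving M T X A B n = (\<Sum>i\<in>A. \<Sum>j\<in>S. reactive_current M T X A B i j n)"
      using n by (simp add: rate_leaving_def sum_reactive_current[OF M X fin(1) assms(1)])
  }
  {
    assume n: "n - 1 \<in> T \<and> n \<in> T"
    have "{w \<in> space M. X n w \<in> B \<and> tau_minus T X A (n - 1) w > tau_minus T X B (n - 1) w} =
      {w \<in> space M. X (n - 1) w \<in> S \<and> X n w \<in> B \<and>
        tau_minus T X A (n - 1) w > tau_minus T X B (n - 1) w \<and>
        tau_plus T X B n w < tau_plus T X A n w}"
      using n by (intro Collect_cong)
        (simp add: in_S first_entrance_immediate[OF _ _ assms(8)] cong: conj_cong)
    then show "rate_entering M T X A B n =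
        (\<Sum>i\<in>S. \<Sum>j\<in>B. reactive_current M T X A B i j (n - 1))"
      using n by (simp add: rate_entering_def sum_reactive_current[OF M X assms(1) fin(2)])
  }
qed

end
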